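(* Let $\mathbb{K}$ be a field of characteristic $0$, $\rho:\mathbb{N}^+\to\mathbb{K}$ any function, and $f(x)\in\mathbb{K}[[x]]$ with $$\sum_{n\ge1}\Big(\sum_{T\in T(n)}\prod_{h\in\mathcal{H}(T)}\rho(h)\Big)\frac{x^n}{n!}=f(x).$$ Then for every $n\ge1$ with $[x^{n-1}]e^{f(x)}\neq0$, $$\rho(n)=\frac{[x^n]f(x)}{[x^{n-1}]e^{f(x)}}.$$
   Context: $T(n)$ is the set of rooted labeled trees on the vertex set $\{1,\dots,n\}$ (children unordered). For a vertex $u$ of $T$, the hook length $h_u$ is the number of descendants of $u$ (counting $u$ itself), and $\mathcal{H}(T)$ is the multiset of hook lengths of all vertices; the product is over all vertices. $[x^n]g(x)$ is the (ordinary) coefficient of $x^n$ in $g(x)$. *)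

theory Defs
  imports "HOL-Library.Multiset" "HOL-Computational_Algebra.Formal_Power_Series"
begin

text \<open>A rooted tree on the vertex set \<open>V\<close> is given by its root \<open>r\<close> and the set \<open>E\<close> of its
  edges, each oriented from parent to child. Siblings carry no order.\<close>

definition rooted_tree_on :: "'v set \<Rightarrow> 'v \<Rightarrow> ('v \<times> 'v) set \<Rightarrow> bool" where
  "rooted_tree_on V r E \<longleftrightarrow>
     r \<in> V \<and> E \<subseteq> V \<times> V \<and>
     (\<nexists>p. (p, r) \<in> E) \<and>
     (\<forall>v\<in>V - {r}. \<exists>!p. (p, v) \<in> E) \<and>
     (\<forall>v\<in>V. (r, v) \<in> E\<^sup>*)"

definition rooted_trees :: "nat \<Rightarrow> (nat \<times> (nat \<times> nat) set) set" where
  "rooted_trees n = {(r, E). rooted_tree_on {1..n} r E}"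

definition descendants :: "'v \<times> ('v \<times> 'v) set \<Rightarrow> 'v \<Rightarrow> 'v set" where
  "descendants T u = {v. (u, v) \<in> (snd T)\<^sup>*}"

definition hook_length :: "'v \<times> ('v \<times> 'v) set \<Rightarrow> 'v \<Rightarrow> nat" where
  "hook_length T u = card (descendants T u)"

definition hook_lengths :: "nat \<Rightarrow> nat \<times> (nat \<times> nat) set \<Rightarrow> nat multiset" where
  "hook_lengths n T = image_mset (hook_length T) (mset_set {1..n})"

lemma finite_rooted_trees: "finite (rooted_trees n)"
  by (rule finite_subset[of _ "{1..n} \<times> Pow ({1..n} \<times> {1..n})"])
     (auto simp: rooted_trees_def rooted_tree_on_def)

text \<open>Descendants are defined by a reflexive closure over the whole type; this confirms that
  for vertices of the tree they stay in the vertex set, so that every hook length is at least 1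
  and at most \<open>n\<close>.\<close>

lemma descendants_subset:
  assumes "T \<in> rooted_trees n" "u \<in> {1..n}"
  shows "u \<in> descendants T u" "descendants T u \<subseteq> {1..n}"
proof -
  show "u \<in> descendants T u"
    by (simp add: descendants_def)
  obtain r E where T: "T = (r, E)" "E \<subseteq> {1..n} \<times> {1..n}"
    using assms(1) by (auto simp: rooted_trees_def rooted_tree_on_def)
  show "descendants T u \<subseteq> {1..n}"
  proof
    fix v assume "v \<in> descendants T u"
    then have "(u, v) \<in> E\<^sup>*" by (simp add: descendants_def T)
    then show "v \<in> {1..n}" 
      using assms(2) T(2) by (induction rule: rtrancl_induct) blast+
  qed
qed

end

theory Submission imports Defs begin

text \<open>Split \<open>\<rho> n\<close>, the factor of the root, off the weight of a tree on \<open>n\<close> vertices. What remains,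
  summed over the trees with a prescribed root, is \<open>a (n - 1)\<close> (\<open>a\<close> is \<open>branch_number \<rho>\<close>), so the
  coefficients of \<open>f\<close> are \<open>n \<rho>(n) a (n - 1) / n!\<close>. Cutting off the branch at the root that contains
  a marked vertex gives \<open>a (n + 1) = (\<Sum>k\<le>n. (n choose k) (k + 1) \<rho>(k + 1) a k a (n - k))\<close>. For the
  exponential generating function \<open>A\<close> of \<open>a\<close> this reads \<open>A' = f' A\<close>, hence \<open>A = exp f\<close>.\<close>

section \<open>Rooted trees and closed vertex sets\<close>

abbreviation hook :: "('v \<times> 'v) set \<Rightarrow> 'v \<Rightarrow> nat" where
  "hook E v \<equiv> card (E\<^sup>* `` {v})"

lemma hook_length_eq_hook: "hook_length (r, E) = hook E"
  by (simp add: fun_eq_iff hook_length_def descendants_def Image_def)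

lemma rooted_tree_onD:
  assumes "rooted_tree_on V r E"
  shows "r \<in> V" "E \<subseteq> V \<times> V" "(p, r) \<notin> E"
    "(p, v) \<in> E \<Longrightarrow> (q, v) \<in> E \<Longrightarrow> p = q"
    "v \<in> V \<Longrightarrow> (r, v) \<in> E\<^sup>*"
  using assms unfolding rooted_tree_on_def by blast+

text \<open>Parents exist by reachability: for \<open>v \<noteq> r\<close> the last edge of a path
  from \<open>r\<close> to \<open>v\<close> supplies one.\<close>

lemma rooted_tree_onI:
  assumes "r \<in> V" "E \<subseteq> V \<times> V" "\<And>p. (p, r) \<notin> E"
    "\<And>p q v. (p, v) \<in> E \<Longrightarrow> (q, v) \<in> E \<Longrightarrow> p = q"
    "\<And>v. v \<in> V \<Longrightarrow> (r, v) \<in> E\<^sup>*"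
  shows "rooted_tree_on V r E"
proof -
  have "\<exists>!p. (p, v) \<in> E" if "v \<in> V - {r}" for v
    using assms(4) assms(5)[of v] that by (auto elim: rtranclE)
  then show ?thesis
    using assms(1,2,3,5) unfolding rooted_tree_on_def by blast
qed

lemma finite_rooted_tree_on: "finite V \<Longrightarrow> finite {E. rooted_tree_on V r E}"
  by (rule finite_subset[of _ "Pow (V \<times> V)"]) (auto dest: rooted_tree_onD(2))

text \<open>A path that starts in a set closed under successors never leaves it. With
  \<open>F = E\<close> this bounds descendant sets; with a part of \<open>E\<close> as
  \<open>F\<close> it moves paths into a subtree.\<close>

lemma rtrancl_closed_transfer:
  assumes "(v, w) \<in> E\<^sup>*" "v \<in> A" "\<And>x y. x \<in> A \<Longrightarrow> (x, y) \<in> E \<Longrightarrow> (x, y) \<in> F \<and> y \<in> A"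
  shows "(v, w) \<in> F\<^sup>* \<and> w \<in> A"
  using assms(1)
proof (induction rule: rtrancl_induct)
  case base
  then show ?case using assms(2) by simp
next
  case (step y z)
  then show ?case using assms(3)[of y z] by (meson rtrancl.rtrancl_into_rtrancl)
qed

lemma hook_closed:
  assumes "F \<subseteq> E" "v \<in> A" "\<And>x y. x \<in> A \<Longrightarrow> (x, y) \<in> E \<Longrightarrow> (x, y) \<in> F \<and> y \<in> A"
  shows "E\<^sup>* `` {v} = F\<^sup>* `` {v}"
  using rtrancl_closed_transfer[of v _ E A F] assms rtrancl_mono[OF assms(1)] by blast

lemma rooted_tree_on_root_descendants:
  assumes "rooted_tree_on V r E"
  shows "E\<^sup>* `` {r} = V"
  using rtrancl_closed_transfer[of r _ E V E] rooted_tree_onD[OF assms] by blast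

section \<open>Grafting a branch onto the root\<close>

definition graft :: "'v \<Rightarrow> 'v set \<times> 'v \<times> ('v \<times> 'v) set \<times> ('v \<times> 'v) set \<Rightarrow> ('v \<times> 'v) set" where
  "graft r = (\<lambda>(S, c, E1, E2). insert (r, c) (E1 \<union> E2))"

text \<open>A quadruple holds the vertex set, root and edges of a branch, then the edges of the tree
  left after cutting it off. Demanding \<open>v0 \<in> S\<close> singles out one of the branches at
  \<open>r\<close>, which makes the cut unique.\<close>

definition grafts ::
  "'v set \<Rightarrow> 'v \<Rightarrow> 'v \<Rightarrow> ('v set \<times> 'v \<times> ('v \<times> 'v) set \<times> ('v \<times> 'v) set) set" where
  "grafts V r v0 = (SIGMA S:{S. v0 \<in> S \<and> S \<subseteq> V - {r}}. SIGMA c:S.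
     {E. rooted_tree_on S c E} \<times> {E. rooted_tree_on (V - S) r E})"

context
  fixes V S :: "'v set" and r c :: 'v and E1 E2 E :: "('v \<times> 'v) set"
  assumes S: "S \<subseteq> V - {r}"
    and E1: "rooted_tree_on S c E1" and E2: "rooted_tree_on (V - S) r E2"
    and E: "E = graft r (S, c, E1, E2)"
begin

lemma graft_edge_iff: "(x, y) \<in> E \<longleftrightarrow> x = r \<and> y = c \<or> (x, y) \<in> E1 \<or> (x, y) \<in> E2"
  by (auto simp: E graft_def)

lemma graft_part1: "(x, y) \<in> E1 \<Longrightarrow> x \<in> S \<and> y \<in> S"
  using rooted_tree_onD[OF E1] by blast

lemma graft_part2: "(x, y) \<in> E2 \<Longrightarrow> x \<in> V - S \<and> y \<in> V - S - {r}"
  using rooted_tree_onD[OF E2] by blast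

lemma graft_roots: "c \<in> S" "r \<in> V" "r \<notin> S"
  using rooted_tree_onD(1)[OF E1] rooted_tree_onD(1)[OF E2] by auto

lemma graft_edge_from: "x \<in> S \<Longrightarrow> (x, y) \<in> E \<Longrightarrow> (x, y) \<in> E1 \<and> y \<in> S"
  using graft_roots by (auto simp: graft_edge_iff dest: graft_part1 graft_part2)

lemma graft_edge_into: "y \<in> S \<Longrightarrow> (x, y) \<in> E \<Longrightarrow> x \<in> S \<or> x = r \<and> y = c"
  by (auto simp: graft_edge_iff dest: graft_part1 graft_part2)

lemma rooted_tree_on_graft: "rooted_tree_on V r E"
proof (rule rooted_tree_onI)
  show "r \<in> V" by (rule graft_roots)
  show "E \<subseteq> V \<times> V"
    using graft_roots S rooted_tree_onD(2)[OF E1] rooted_tree_onD(2)[OF E2]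
    by (auto simp: E graft_def)
  show "(p, r) \<notin> E" for p
    using graft_roots by (auto simp: graft_edge_iff dest: graft_part1 graft_part2)
  show "p = q" if "(p, v) \<in> E" "(q, v) \<in> E" for p q v
    using that rooted_tree_onD(3,4)[OF E1] rooted_tree_onD(4)[OF E2]
      graft_part1 graft_part2 graft_roots unfolding graft_edge_iff by blast
  show "(r, v) \<in> E\<^sup>*" if "v \<in> V" for v
  proof (cases "v \<in> S")
    case True
    have "E1\<^sup>* \<subseteq> E\<^sup>*"
      using graft_edge_iff by (intro rtrancl_mono) auto
    then have "(c, v) \<in> E\<^sup>*"
      using rooted_tree_onD(5)[OF E1 True] by blast
    then show ?thesis
      by (rule converse_rtrancl_into_rtrancl[rotated]) (simp add: graft_edge_iff)
  next
    case False
    have "E2\<^sup>* \<subseteq> E\<^sup>*"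
      using graft_edge_iff by (intro rtrancl_mono) auto
    then show ?thesis
      using rooted_tree_onD(5)[OF E2, of v] False that by blast
  qed
qed

lemma graft_descendants1: "v \<in> S \<Longrightarrow> E\<^sup>* `` {v} = E1\<^sup>* `` {v}"
  by (rule hook_closed[where A = S]) (auto simp: graft_edge_iff dest: graft_edge_from)

text \<open>Only \<open>r\<close> has an edge into \<open>S\<close>, so \<open>V - S - {r}\<close>
  is closed under successors. The hook of \<open>r\<close> itself does change.\<close>

lemma graft_descendants2: "v \<in> V - S - {r} \<Longrightarrow> E\<^sup>* `` {v} = E2\<^sup>* `` {v}"
  by (rule hook_closed[where A = "V - S - {r}"])
    (auto simp: graft_edge_iff dest: graft_part1 graft_part2)

lemma graft_descendants_branch_root: "E\<^sup>* `` {c} = S"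
  using graft_descendants1[OF graft_roots(1)] rooted_tree_on_root_descendants[OF E1] by simp

lemma graft_restrict: "E \<inter> S \<times> S = E1" "E \<inter> (V - S) \<times> (V - S) = E2"
  using graft_roots by (auto simp: graft_edge_iff dest: graft_part1 graft_part2)

text \<open>A path can enter \<open>S\<close> from outside only through the edge
  \<open>(r, c)\<close>, so it visits \<open>r\<close> first.\<close>

lemma graft_path_into: "(x, y) \<in> E\<^sup>* \<Longrightarrow> y \<in> S \<Longrightarrow> x \<in> S \<or> (x, r) \<in> E\<^sup>*"
proof (induction rule: converse_rtrancl_induct)
  case base
  then show ?case by simp
next
  case (step x z)
  then show ?case
    using graft_edge_into[of z x] by (auto intro: converse_rtrancl_into_rtrancl)
qed

end

text \<open>In the common tree \<open>c\<close> reaches \<open>v0\<close> but not \<open>r\<close>,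
  so its path to \<open>v0\<close> cannot enter \<open>S'\<close> from outside; thus
  \<open>c \<in> S'\<close>. As \<open>S'\<close> is closed under successors, it contains all
  descendants of \<open>c\<close>, which make up \<open>S\<close>. Exchanging the roles gives
  \<open>S = S'\<close>.\<close>

lemma graft_branch_subset:
  assumes "S \<subseteq> V - {r}" "rooted_tree_on S c E1" "rooted_tree_on (V - S) r E2"
    and "S' \<subseteq> V - {r}" "rooted_tree_on S' c' E1'" "rooted_tree_on (V - S') r E2'"
    and eq: "graft r (S, c, E1, E2) = graft r (S', c', E1', E2')"
    and "v0 \<in> S" "v0 \<in> S'"
  shows "S \<subseteq> S'" "c \<in> S'"
proof -
  let ?E = "graft r (S, c, E1, E2)"
  note g = assms(1-3) refl[of ?E]
  note g' = assms(4-6) eq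
  have S: "?E\<^sup>* `` {c} = S"
    by (rule graft_descendants_branch_root[OF g])
  then have "(c, v0) \<in> ?E\<^sup>*" "(c, r) \<notin> ?E\<^sup>*"
    using assms(8) graft_roots[OF g] by blast+
  then show c: "c \<in> S'"
    using graft_path_into[OF g'] assms(9) by blast
  show "S \<subseteq> S'"
  proof
    fix v assume "v \<in> S"
    then have "(c, v) \<in> ?E\<^sup>*" using S by blast
    then show "v \<in> S'"
      using rtrancl_closed_transfer[of c v ?E S' E1'] graft_edge_from[OF g'] c by blast
  qed
qed

lemma inj_on_graft: "inj_on (graft r) (grafts V r v0)"
proof (rule inj_onI)
  fix x y assume xy: "x \<in> grafts V r v0" "y \<in> grafts V r v0" "graft r x = graft r y"
  obtain S c E1 E2 where x: "x = (S, c, E1, E2)" by (cases x)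
  obtain S' c' E1' E2' where y: "y = (S', c', E1', E2')" by (cases y)
  note eq = xy(3)[unfolded x y]
  have v: "v0 \<in> S" "v0 \<in> S'" using xy by (auto simp: x y grafts_def)
  have g: "S \<subseteq> V - {r}" "rooted_tree_on S c E1" "rooted_tree_on (V - S) r E2"
    using xy by (auto simp: x grafts_def)
  have g': "S' \<subseteq> V - {r}" "rooted_tree_on S' c' E1'" "rooted_tree_on (V - S') r E2'"
    using xy by (auto simp: y grafts_def)
  have S: "S = S'"
    using graft_branch_subset[OF g g' eq v] graft_branch_subset[OF g' g eq[symmetric] v(2,1)] by blast
  \<comment> \<open>The edge \<open>(r, c)\<close> enters \<open>S'\<close> from outside, which only
    \<open>(r, c')\<close> does.\<close>
  have "(r, c) \<in> graft r (S', c', E1', E2')"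
    using eq by (auto simp: graft_def)
  then have "c = c'"
    using graft_edge_into[OF g' refl, of c r] graft_branch_subset(2)[OF g g' eq v]
      graft_roots[OF g' refl] by blast
  moreover have "E1 = E1'" "E2 = E2'"
    using graft_restrict[OF g refl] graft_restrict[OF g' refl] eq S by simp_all
  ultimately show "x = y" using x y S by simp
qed

text \<open>Surjectivity of grafting: take for \<open>c\<close> the first vertex after
  \<open>r\<close> on a path to \<open>v0\<close>, and for \<open>S\<close> the descendants of
  \<open>c\<close>.\<close>

lemma rooted_tree_on_is_graft:
  assumes T: "rooted_tree_on V r E" and v0: "v0 \<in> V - {r}"
  shows "E \<in> graft r ` grafts V r v0"
proof -
  note T = rooted_tree_onD[OF T]
  obtain c where rc: "(r, c) \<in> E" and cv0: "(c, v0) \<in> E\<^sup>*"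
    using T(5)[of v0] v0 by (auto elim: converse_rtranclE)
  define S where "S = E\<^sup>* `` {c}"
  have cS: "c \<in> S" and v0S: "v0 \<in> S"
    using cv0 by (auto simp: S_def)
  have closed: "y \<in> S" if "x \<in> S" "(x, y) \<in> E" for x y
    using that by (auto simp: S_def intro: rtrancl_into_rtrancl)
  have SV: "S \<subseteq> V"
    using rtrancl_closed_transfer[of c _ E V E] rc T(2) by (auto simp: S_def)
  have rS: "r \<notin> S"
    using rc T(3) by (auto simp: S_def elim: rtranclE)
  \<comment> \<open>If the path from \<open>c\<close> to \<open>y\<close> is empty, then
    \<open>y = c\<close>, whose only parent is \<open>r\<close>. Otherwise its last edge starts in
    \<open>S\<close>, and unique parents force \<open>x\<close> to be that starting point.\<close>
  have into: "x \<in> S \<or> x = r \<and> y = c" if "y \<in> S" "(x, y) \<in> E" for x y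
  proof -
    from that(1) have "(c, y) \<in> E\<^sup>*" by (simp add: S_def)
    then show ?thesis
    proof (cases rule: rtranclE)
      case base
      then show ?thesis using that rc T(4) by blast
    next
      case (step z)
      then show ?thesis using that T(4)[of x y z] by (auto simp: S_def)
    qed
  qed
  define E1 where "E1 = E \<inter> S \<times> S"
  define E2 where "E2 = E \<inter> (V - S) \<times> (V - S)"
  have "E = graft r (S, c, E1, E2)"
    using rc into closed T(2) by (auto simp: graft_def E1_def E2_def)
  moreover have "rooted_tree_on S c E1"
  proof (rule rooted_tree_onI)
    show "(p, c) \<notin> E1" for p
      using rc rS T(4) by (auto simp: E1_def)
    show "(c, v) \<in> E1\<^sup>*" if "v \<in> S" for v
      using that rtrancl_closed_transfer[of c v E S E1] cS closed by (auto simp: S_def E1_def)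
  qed (use cS T(4) in \<open>auto simp: E1_def\<close>)
  moreover have "rooted_tree_on (V - S) r E2"
  proof (rule rooted_tree_onI)
    \<comment> \<open>Since \<open>S\<close> is closed under successors, a path ending outside
      \<open>S\<close> has avoided it throughout.\<close>
    have "(r, v) \<in> E\<^sup>* \<Longrightarrow> v \<notin> S \<Longrightarrow> (r, v) \<in> E2\<^sup>*" for v
    proof (induction rule: rtrancl_induct)
      case (step y z)
      then have "(y, z) \<in> E2" "y \<notin> S"
        using closed T(2) by (auto simp: E2_def)
      then show ?case using step by (meson rtrancl.rtrancl_into_rtrancl)
    qed simp
    then show "(r, v) \<in> E2\<^sup>*" if "v \<in> V - S" for v
      using that T(5) by blast
  qed (use rS T in \<open>auto simp: E2_def\<close>)
  ultimately show ?thesis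
    using cS v0S SV rS by (intro image_eqI[of _ _ "(S, c, E1, E2)"]) (auto simp: grafts_def)
qed

lemma bij_betw_graft:
  assumes "v0 \<in> V - {r}"
  shows "bij_betw (graft r) (grafts V r v0) {E. rooted_tree_on V r E}"
  unfolding bij_betw_def
proof (intro conjI inj_on_graft equalityI subsetI)
  fix E assume "E \<in> graft r ` grafts V r v0"
  then show "E \<in> {E. rooted_tree_on V r E}"
    by (auto simp: grafts_def intro: rooted_tree_on_graft)
qed (use rooted_tree_on_is_graft[OF _ assms] in auto)

section \<open>Weighted sums over trees with a fixed root\<close>

definition branch_sum :: "(nat \<Rightarrow> 'k::comm_semiring_1) \<Rightarrow> 'v set \<Rightarrow> 'v \<Rightarrow> 'k" where
  "branch_sum \<rho> V r = (\<Sum>E | rooted_tree_on V r E. \<Prod>v\<in>V - {r}. \<rho> (hook E v))"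

lemma branch_sum_singleton: "branch_sum \<rho> {r} r = 1"
proof -
  have "{E. rooted_tree_on {r} r E} = {{}}"
    by (auto simp: rooted_tree_on_def)
  then show ?thesis by (simp add: branch_sum_def)
qed

text \<open>Every vertex descends from the root, so the factor of the root is the same for all trees
  and comes out of the sum.\<close>

lemma sum_prod_hook_eq_branch_sum:
  assumes "finite V" "r \<in> V"
  shows "(\<Sum>E | rooted_tree_on V r E. \<Prod>v\<in>V. \<rho> (hook E v)) = \<rho> (card V) * branch_sum \<rho> V r"
  unfolding branch_sum_def sum_distrib_left
  using assms by (intro sum.cong refl) (simp add: prod.remove[of V r] rooted_tree_on_root_descendants)

text \<open>Cutting preserves all hooks except that of \<open>r\<close>, whose factor is left out of
  \<open>branch_sum\<close>, so the weights multiply. The branch also brings in the factor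
  \<open>\<rho> (card S)\<close> of its own root \<open>c\<close>.\<close>

lemma branch_sum_rec:
  assumes V: "finite V" and v0: "v0 \<in> V - {r}"
  shows "branch_sum \<rho> V r = (\<Sum>S | v0 \<in> S \<and> S \<subseteq> V - {r}.
           (\<Sum>c\<in>S. \<rho> (card S) * branch_sum \<rho> S c) * branch_sum \<rho> (V - S) r)"
proof -
  have "branch_sum \<rho> V r = (\<Sum>x\<in>grafts V r v0. \<Prod>v\<in>V - {r}. \<rho> (hook (graft r x) v))"
    unfolding branch_sum_def by (rule sum.reindex_bij_betw[OF bij_betw_graft[OF v0], symmetric])
  also have "\<dots> = (\<Sum>(S, c, E1, E2)\<in>grafts V r v0.
      (\<Prod>v\<in>S. \<rho> (hook E1 v)) * (\<Prod>v\<in>V - S - {r}. \<rho> (hook E2 v)))"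
  proof (intro sum.cong refl, clarify)
    fix S c E1 E2 assume "(S, c, E1, E2) \<in> grafts V r v0"
    then have g: "S \<subseteq> V - {r}" "rooted_tree_on S c E1" "rooted_tree_on (V - S) r E2"
      by (auto simp: grafts_def)
    have "V - {r} = S \<union> (V - S - {r})" using g(1) by auto
    then have "(\<Prod>v\<in>V - {r}. \<rho> (hook (graft r (S, c, E1, E2)) v)) =
        (\<Prod>v\<in>S. \<rho> (hook (graft r (S, c, E1, E2)) v)) *
        (\<Prod>v\<in>V - S - {r}. \<rho> (hook (graft r (S, c, E1, E2)) v))"
      using V g(1) by (subst prod.union_disjoint[symmetric]) (auto intro: finite_subset)
    then show "(\<Prod>v\<in>V - {r}. \<rho> (hook (graft r (S, c, E1, E2)) v)) =
        (\<Prod>v\<in>S. \<rho> (hook E1 v)) * (\<Prod>v\<in>V - S - {r}. \<rho> (hook E2 v))"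
      using graft_descendants1[OF g refl] graft_descendants2[OF g refl] by simp
  qed
  also have "\<dots> = (\<Sum>S | v0 \<in> S \<and> S \<subseteq> V - {r}. \<Sum>c\<in>S.
      (\<Sum>E1 | rooted_tree_on S c E1. \<Prod>v\<in>S. \<rho> (hook E1 v)) * branch_sum \<rho> (V - S) r)"
  proof -
    have fin: "finite {S. v0 \<in> S \<and> S \<subseteq> V - {r}}"
      using V by (auto intro: finite_subset[of _ "Pow V"])
    have finS: "finite S" if "v0 \<in> S \<and> S \<subseteq> V - {r}" for S
      using that V by (auto intro: finite_subset[of _ V])
    show ?thesis
      unfolding grafts_def branch_sum_def using fin finS V
      by (simp add: sum.Sigma[symmetric] finite_rooted_tree_on finite_SigmaI
          sum.cartesian_product[symmetric] sum_product)
  qed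
  also have "\<dots> = (\<Sum>S | v0 \<in> S \<and> S \<subseteq> V - {r}.
           (\<Sum>c\<in>S. \<rho> (card S) * branch_sum \<rho> S c) * branch_sum \<rho> (V - S) r)"
  proof (intro sum.cong refl)
    fix S assume "S \<in> {S. v0 \<in> S \<and> S \<subseteq> V - {r}}"
    then have "finite S" using V by (auto intro: finite_subset[of _ V])
    then show "(\<Sum>c\<in>S. (\<Sum>E1 | rooted_tree_on S c E1. \<Prod>v\<in>S. \<rho> (hook E1 v)) * branch_sum \<rho> (V - S) r)
        = (\<Sum>c\<in>S. \<rho> (card S) * branch_sum \<rho> S c) * branch_sum \<rho> (V - S) r"
      by (simp add: sum_prod_hook_eq_branch_sum sum_distrib_right)
  qed
  finally show ?thesis .
qed

section \<open>Reduction to cardinalities\<close>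

fun branch_number :: "(nat \<Rightarrow> 'k::comm_semiring_1) \<Rightarrow> nat \<Rightarrow> 'k" where
  "branch_number \<rho> 0 = 1"
| "branch_number \<rho> (Suc n) = (\<Sum>k\<le>n. of_nat (n choose k) *
     (of_nat (Suc k) * \<rho> (Suc k) * branch_number \<rho> k * branch_number \<rho> (n - k)))"

text \<open>Removing \<open>v0\<close> leaves an arbitrary subset of an \<open>n\<close>-element
  set, so the size \<open>Suc k\<close> occurs \<open>n choose k\<close> times.\<close>

lemma sum_over_subsets_containing:
  fixes g :: "nat \<Rightarrow> 'k::comm_semiring_1"
  assumes W: "finite W" "v0 \<in> W" "card W = Suc n"
  shows "(\<Sum>S | v0 \<in> S \<and> S \<subseteq> W. g (card S)) = (\<Sum>k\<le>n. of_nat (n choose k) * g (Suc k))"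
proof -
  let ?W = "W - {v0}"
  have W': "finite ?W" "card ?W = n" using W by auto
  have "(\<Sum>S | v0 \<in> S \<and> S \<subseteq> W. g (card S)) = (\<Sum>U\<in>Pow ?W. g (Suc (card U)))"
  proof (rule sum.reindex_bij_witness[of _ "insert v0" "\<lambda>S. S - {v0}"])
    fix S assume S: "S \<in> {S. v0 \<in> S \<and> S \<subseteq> W}"
    then have "finite S" using W(1) by (auto intro: finite_subset)
    then show "g (Suc (card (S - {v0}))) = g (card S)"
      using S by (simp only: card_Suc_Diff1 mem_Collect_eq)
  qed (use W(2) in auto)
  also have "\<dots> = (\<Sum>k\<le>n. \<Sum>U | U \<in> Pow ?W \<and> card U = k. g (Suc (card U)))"
    using W' by (intro sum.group[symmetric]) (auto intro: card_mono)
  also have "\<dots> = (\<Sum>k\<le>n. of_nat (n choose k) * g (Suc k))"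
    using n_subsets[OF W'(1)] W'(2) by (intro sum.cong) auto
  finally show ?thesis .
qed

text \<open>The index counts the vertices other than the root. Induction on \<open>card V\<close>
  applies to both parts of a cut, since \<open>S\<close> misses \<open>r\<close> and
  \<open>V - S\<close> misses \<open>v0\<close>.\<close>

lemma branch_sum_eq_branch_number:
  assumes "finite V" "r \<in> V"
  shows "branch_sum \<rho> V r = branch_number \<rho> (card V - 1)"
  using assms
proof (induction "card V" arbitrary: V r rule: less_induct)
  case less
  have card: "card (V - {r}) = card V - 1" using less.prems by simp
  show ?case
  proof (cases "card V - 1")
    case 0
    then have "V - {r} = {}" using card less.prems by (metis card_eq_0_iff finite_Diff)
    then have "V = {r}" using less.prems by auto
    then show ?thesis by (simp add: branch_sum_singleton)
  next
    case (Suc n)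
    then have "V - {r} \<noteq> {}" using card by (metis card.empty nat.distinct(1))
    then obtain v0 where v0: "v0 \<in> V - {r}" by blast
    \<comment> \<open>The contribution of a branch with \<open>k\<close> vertices, \<open>k\<close>
      being also the number of choices for its root. As \<open>card V = n + 2\<close>, the other
      part has \<open>Suc n - k\<close> vertices besides \<open>r\<close>.\<close>
    define g where "g k = of_nat k * \<rho> k * branch_number \<rho> (k - 1) * branch_number \<rho> (Suc n - k)" for k
    have "(\<Sum>c\<in>S. \<rho> (card S) * branch_sum \<rho> S c) * branch_sum \<rho> (V - S) r = g (card S)"
      if S: "v0 \<in> S \<and> S \<subseteq> V - {r}" for S
    proof -
      have fin: "finite S" using S less.prems by (auto intro: finite_subset[of _ V])
      have "card S < card V"
        using S less.prems by (intro psubset_card_mono) auto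
      then have "branch_sum \<rho> S c = branch_number \<rho> (card S - 1)" if "c \<in> S" for c
        using less.hyps that fin by blast
      moreover have "card (V - S) < card V"
        using S less.prems by (intro psubset_card_mono) auto
      then have "branch_sum \<rho> (V - S) r = branch_number \<rho> (card (V - S) - 1)"
        using less.hyps S less.prems by blast
      moreover have "card (V - S) = card V - card S"
        using S fin by (intro card_Diff_subset) auto
      moreover have "card V = Suc (Suc n)"
        using Suc by simp
      ultimately show ?thesis
        by (simp add: g_def mult.assoc)
    qed
    then have "branch_sum \<rho> V r = (\<Sum>S | v0 \<in> S \<and> S \<subseteq> V - {r}. g (card S))"
      unfolding branch_sum_rec[OF less.prems(1) v0] by (intro sum.cong) auto
    also have "\<dots> = (\<Sum>k\<le>n. of_nat (n choose k) * g (Suc k))"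
      using less.prems v0 Suc card by (intro sum_over_subsets_containing) auto
    finally show ?thesis
      using Suc by (simp add: g_def)
  qed
qed

text \<open>Each of the \<open>n\<close> possible roots contributes the same amount. For
  \<open>n = 0\<close> there is no root to choose, and both sides are 0.\<close>

lemma sum_rooted_trees:
  "(\<Sum>T\<in>rooted_trees n. \<Prod>h\<in>#hook_lengths n T. \<rho> h) = of_nat n * \<rho> n * branch_number \<rho> (n - 1)"
proof -
  have trees: "rooted_trees n = (SIGMA r:{1..n}. {E. rooted_tree_on {1..n} r E})"
    by (auto simp: rooted_trees_def dest: rooted_tree_onD(1))
  have "(\<Sum>T\<in>rooted_trees n. \<Prod>h\<in>#hook_lengths n T. \<rho> h) =
      (\<Sum>(r, E)\<in>rooted_trees n. \<Prod>v\<in>{1..n}. \<rho> (hook E v))"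
    by (intro sum.cong refl)
      (auto simp: hook_lengths_def hook_length_eq_hook prod_unfold_prod_mset
        multiset.map_comp comp_def)
  also have "\<dots> = (\<Sum>r\<in>{1..n}. \<rho> n * branch_sum \<rho> {1..n} r)"
    unfolding trees
    by (simp add: sum.Sigma[symmetric] finite_rooted_tree_on sum_prod_hook_eq_branch_sum
        del: One_nat_def)
  also have "\<dots> = of_nat n * \<rho> n * branch_number \<rho> (n - 1)"
    by (simp add: branch_sum_eq_branch_number mult.assoc)
  finally show ?thesis .
qed

section \<open>Exponential generating functions\<close>

lemma fps_deriv_eq_mult_unique:
  fixes A B h :: "'k::field_char_0 fps"
  assumes "fps_deriv A = h * A" "fps_deriv B = h * B" "fps_nth A 0 = fps_nth B 0"
  shows "A = B"
proof (rule fps_ext)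
  fix n show "fps_nth A n = fps_nth B n"
  proof (induction n rule: less_induct)
    case (less n)
    show ?case
    proof (cases n)
      case 0
      then show ?thesis using assms(3) by simp
    next
      case (Suc m)
      \<comment> \<open>Coefficient \<open>m\<close> of \<open>h * A\<close> involves only
        coefficients of \<open>A\<close> up to \<open>m\<close>, which the induction hypothesis
        covers. On the derivative side it is \<open>Suc m\<close> times coefficient
        \<open>Suc m\<close>, and \<open>Suc m\<close> cancels in characteristic 0.\<close>
      have "fps_nth (h * A) m = fps_nth (h * B) m"
        using less Suc by (simp add: fps_mult_nth)
      then have "fps_nth (fps_deriv A) m = fps_nth (fps_deriv B) m"
        using assms by simp
      then show ?thesis using Suc by (simp del: of_nat_Suc)
    qed
  qed
qed

theorem theorem4p1:
  fixes \<rho> :: "nat \<Rightarrow> 'k::field_char_0"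
    and f :: "'k fps"
  assumes "Abs_fps (\<lambda>n. if n \<ge> 1
             then (\<Sum>T\<in>rooted_trees n. \<Prod>h\<in>#hook_lengths n T. \<rho> h) / fact n
             else 0) = f"
  shows "\<forall>n\<ge>1. fps_nth (fps_compose (fps_exp 1) f) (n - 1) \<noteq> 0 \<longrightarrow>
           \<rho> n = fps_nth f n / fps_nth (fps_compose (fps_exp 1) f) (n - 1)"
proof -
  define A where "A = Abs_fps (\<lambda>n. branch_number \<rho> n / fact n)"
  \<comment> \<open>The default value at index 0 makes the constant term vanish, as the chain rule
    for \<open>fps_exp 1 oo f\<close> requires.\<close>
  have f0: "fps_nth f 0 = 0"
    using assms by auto
  have f_Suc: "fps_nth f (Suc n) = \<rho> (Suc n) * branch_number \<rho> n / fact n" for n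
    unfolding assms[symmetric] by (simp add: sum_rooted_trees field_simps del: of_nat_Suc)
  have "fps_deriv A = fps_deriv f * A"
  proof (rule fps_ext)
    fix n
    have "fps_nth (fps_deriv A) n = branch_number \<rho> (Suc n) / fact n"
      by (simp add: A_def field_simps del: of_nat_Suc branch_number.simps)
    \<comment> \<open>Dividing \<open>n choose k\<close> by \<open>fact n\<close> leaves
      \<open>1 / (fact k * fact (n - k))\<close>, which turns the recursion into a Cauchy
      product.\<close>
    also have "\<dots> = (\<Sum>k\<le>n. of_nat (Suc k) * \<rho> (Suc k) * branch_number \<rho> k / fact k *
        (branch_number \<rho> (n - k) / fact (n - k)))"
      by (simp add: sum_divide_distrib binomial_fact field_simps del: of_nat_Suc)
    also have "\<dots> = fps_nth (fps_deriv f * A) n"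
      by (simp add: fps_mult_nth A_def f_Suc atLeast0AtMost mult.assoc del: of_nat_Suc)
    finally show "fps_nth (fps_deriv A) n = fps_nth (fps_deriv f * A) n" .
  qed
  moreover have "fps_deriv (fps_exp 1 oo f) = fps_deriv f * (fps_exp 1 oo f)"
    using fps_compose_deriv[OF f0, of "fps_exp 1"] by simp
  moreover have "fps_nth (fps_exp 1 oo f) 0 = fps_nth A 0"
    by (simp add: A_def)
  \<comment> \<open>Both series solve \<open>y' = f' y\<close> with constant term 1.\<close>
  ultimately have exp_f: "fps_exp 1 oo f = A"
    by (metis fps_deriv_eq_mult_unique)
  show ?thesis
  proof (intro allI impI)
    fix n :: nat assume "1 \<le> n" and nz: "fps_nth (fps_exp 1 oo f) (n - 1) \<noteq> 0"
    then obtain m where n: "n = Suc m" by (cases n) auto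
    \<comment> \<open>By \<open>f_Suc\<close>, the cofactor of \<open>\<rho> n\<close> is exactly
      coefficient \<open>n - 1\<close> of \<open>A\<close>.\<close>
    have "fps_nth f n = \<rho> n * fps_nth (fps_exp 1 oo f) (n - 1)"
      by (simp add: exp_f n f_Suc A_def)
    then show "\<rho> n = fps_nth f n / fps_nth (fps_exp 1 oo f) (n - 1)"
      using nz by simp
  qed
qed

end
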